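(* There exists a $2$-fold colouring of $G_{[1,1]}$ with $12$ colours, and there exists a $3$-fold colouring of $G_{[1,1]}$ with $16$ colours. That is, $\chi_2(G_{[1,1]})\le 12$ and $\chi_3(G_{[1,1]})\le 16$.
   Context: $G_{[1,1]}$ is the unit distance graph: vertex set $\mathbb{R}^2$, two points adjacent if and only if their Euclidean distance is exactly $1$. For positive integers $j\le k$, a $j$-fold colouring of a graph $G=(V,E)$ with $k$ colours is a map $f$ assigning to each vertex a $j$-element subset of $\{1,\dots,k\}$ such that $f(v)\cap f(w)=\emptyset$ whenever $v,w$ are adjacent; $\chi_j(G)$ is the least such $k$. *)

theory Defs
  imports "HOL-Analysis.Analysis"
begin

text \<open>A graph is a pair of a vertex set and an adjacency relation; only the adjacencies
  between elements of the vertex set matter.\<close>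

type_synonym 'a graph = "'a set \<times> ('a \<Rightarrow> 'a \<Rightarrow> bool)"

definition unit_distance_graph :: "(real ^ 2) graph" where
  "unit_distance_graph = (UNIV, \<lambda>v w. dist v w = 1)"

definition fold_colouring :: "'a graph \<Rightarrow> nat \<Rightarrow> nat \<Rightarrow> ('a \<Rightarrow> nat set) \<Rightarrow> bool" where
  "fold_colouring G j k f \<longleftrightarrow>
     1 \<le> j \<and> j \<le> k \<and>
     (\<forall>v\<in>fst G. f v \<subseteq> {1..k} \<and> card (f v) = j) \<and>
     (\<forall>v\<in>fst G. \<forall>w\<in>fst G. snd G v w \<longrightarrow> f v \<inter> f w = {})"

text \<open>The value is meaningful only if some \<open>j\<close>-fold colouring with finitely many colours exists.
  An upper bound on it should therefore be accompanied by the existence of a colouring.\<close>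

definition fold_chromatic_number :: "'a graph \<Rightarrow> nat \<Rightarrow> nat" where
  "fold_chromatic_number G j = (LEAST k. \<exists>f. fold_colouring G j k f)"

end

(* Both colourings paint the translates T + p of a hexagon T, p ranging over the lattice M = Z^2 in
   suitable linear coordinates, by the class of p modulo a sublattice L. A point receives as many
   colours as there are translates covering it, and the colouring is proper if the difference body
   T - T lies strictly inside the unit circle while its translates by nonzero vectors of L lie
   strictly outside.

   For 3 of 16 colours, M is the triangular lattice with spacing 1/2, L = 4M, and T is the regular
   hexagon of diameter 1 whose vertices are the minimal vectors of M; the metric is tight at the
   vertices, so the choice of the boundary matters. For 2 of 12 colours, M is a rectangular lattice
   in which the tiling lattice of a regular hexagon T has index 2, and L is the lattice of index 12
   generated by (3,2) and (3,-2); here there is slack, and T can be a closed hexagon. *)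

theory Submission
  imports Defs
begin

section \<open>Multi-fold colourings from coloured covers of the plane\<close>

lemma fold_colouring_of_colour_sets:
  fixes F :: "'a \<Rightarrow> nat set"
  assumes "1 \<le> j"
    and sub: "\<And>v. F v \<subseteq> {1..k}"
    and enough: "\<And>v. j \<le> card (F v)"
    and disj: "\<And>v w. adj v w \<Longrightarrow> F v \<inter> F w = {}"
  shows "\<exists>f. fold_colouring (V, adj) j k f"
proof -
  \<comment> \<open>Surplus colours can be discarded: subsets of disjoint sets stay
    disjoint.\<close>
  have "\<exists>A\<subseteq>F v. card A = j" for v
    using obtain_subset_with_card_n[OF enough[of v]] by metis
  then obtain f where f: "\<And>v. f v \<subseteq> F v" "\<And>v. card (f v) = j" by metis
  have "j \<le> card {1..k}"
    using enough[of undefined] card_mono[OF _ sub[of undefined]] by simp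
  then have "fold_colouring (V, adj) j k f"
    unfolding fold_colouring_def using assms(1) f sub disj by simp blast
  then show ?thesis by blast
qed

text \<open>\<open>X\<close> and \<open>Y\<close> serve as lattice coordinates of a vertex. The
  assumption \<open>proper\<close> covers the case of one and the same translate, so it also forbids
  adjacent vertices inside a single tile.\<close>

lemma fold_colouring_of_lattice_colouring:
  fixes X Y :: "'a \<Rightarrow> real" and T :: "(real \<times> real) set" and \<kappa> :: "int \<Rightarrow> int \<Rightarrow> nat"
  assumes "1 \<le> j"
    and range: "\<And>m n. \<kappa> m n \<in> {1..k}"
    and enough: "\<And>x y. \<exists>C. card C = j \<and> C \<subseteq> {\<kappa> m n |m n. (x - of_int m, y - of_int n) \<in> T}"
    and proper: "\<And>v w m n m' n'. \<lbrakk>adj v w; (X v - of_int m, Y v - of_int n) \<in> T;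
        (X w - of_int m', Y w - of_int n') \<in> T\<rbrakk> \<Longrightarrow> \<kappa> m n \<noteq> \<kappa> m' n'"
  shows "\<exists>f. fold_colouring (V, adj) j k f"
proof (rule fold_colouring_of_colour_sets)
  define F where "F v = {\<kappa> m n |m n. (X v - of_int m, Y v - of_int n) \<in> T}" for v
  show sub: "F v \<subseteq> {1..k}" for v
    unfolding F_def using range by auto
  show "j \<le> card (F v)" for v
  proof -
    obtain C where "card C = j" "C \<subseteq> F v"
      unfolding F_def using enough by blast
    then show ?thesis
      using card_mono[of "F v" C] finite_subset[OF sub] by auto
  qed
  show "F v \<inter> F w = {}" if "adj v w" for v w
    unfolding F_def using proper[OF that] by blast
qed fact

lemma dist_real2_eq_1D:
  fixes v w :: "real ^ 2"
  assumes "dist v w = 1"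
  shows "(v $ 1 - w $ 1)\<^sup>2 + (v $ 2 - w $ 2)\<^sup>2 = 1"
  using assms by (simp add: dist_vec_def L2_set_def sum_2 dist_real_def)

section \<open>Three of sixteen colours\<close>

(* Of its boundary, this hexagon contains three consecutive edges and only the vertices (0,1) and
   (-1,1). It therefore contains no antipodal pair of vertices, the only pairs realising its
   diameter, and its translates by M cover every point exactly three times. *)
definition half_open_hexagon :: "(real \<times> real) set" where
  "half_open_hexagon = {(x, y). - 1 \<le> x \<and> x < 1 \<and> - 1 < y \<and> y \<le> 1 \<and> - 1 < x + y \<and> x + y \<le> 1}"

definition colour16 :: "int \<Rightarrow> int \<Rightarrow> nat" where
  "colour16 m n = nat (m mod 4 + 4 * (n mod 4) + 1)"

lemma colour16_range: "colour16 m n \<in> {1..16}"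
proof -
  have "0 \<le> m mod 4" "m mod 4 < 4" "0 \<le> n mod 4" "n mod 4 < 4" by simp_all
  then show ?thesis unfolding colour16_def by auto
qed

lemma colour16_eqD:
  assumes "colour16 m n = colour16 m' n'"
  shows "4 dvd m - m'" and "4 dvd n - n'"
proof -
  have eq: "m mod 4 + 4 * (n mod 4) = m' mod 4 + 4 * (n' mod 4)"
    using assms unfolding colour16_def by (subst (asm) eq_nat_nat_iff) simp_all
  have "0 \<le> m mod 4" "m mod 4 < 4" "0 \<le> m' mod 4" "m' mod 4 < 4" by simp_all
  with eq have mod_n: "n mod 4 = n' mod 4" by linarith
  with eq have "m mod 4 = m' mod 4" by simp
  with mod_n show "4 dvd m - m'" "4 dvd n - n'" by (simp_all add: mod_eq_dvd_iff)
qed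

lemma half_open_hexagon_covers:
  fixes x y :: real
  shows "\<exists>C. card C = 3 \<and>
    C \<subseteq> {colour16 m n |m n. (x - of_int m, y - of_int n) \<in> half_open_hexagon}"
proof -
  define m n where "m = \<lfloor>x\<rfloor>" and "n = \<lfloor>y\<rfloor>"
  define F where "F = {colour16 m n |m n. (x - of_int m, y - of_int n) \<in> half_open_hexagon}"
  have b: "of_int m \<le> x" "x < of_int m + 1" "of_int n \<le> y" "y < of_int n + 1"
    unfolding m_def n_def by linarith+
  have mem: "colour16 (m + i) (n + j) \<in> F"
    if "(x - of_int m - of_int i, y - of_int n - of_int j) \<in> half_open_hexagon" for i j
  proof -
    have "(x - of_int (m + i), y - of_int (n + j)) \<in> half_open_hexagon"
      using that by (simp add: algebra_simps)
    then show ?thesis unfolding F_def by blast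
  qed
  have neq: "colour16 (m + i) (n + j) \<noteq> colour16 (m + i') (n + j')"
    if "\<not> (4 dvd i - i' \<and> 4 dvd j - j')" for i j i' j'
    using that colour16_eqD[of "m + i" "n + j" "m + i'" "n + j'"] by auto
  have three: "\<exists>C. card C = 3 \<and> C \<subseteq> F"
    if "colour16 (m + i) (n + j) \<in> F" "colour16 (m + i') (n + j') \<in> F"
      "colour16 (m + i'') (n + j'') \<in> F"
      "\<not> (4 dvd i - i' \<and> 4 dvd j - j')" "\<not> (4 dvd i - i'' \<and> 4 dvd j - j'')"
      "\<not> (4 dvd i' - i'' \<and> 4 dvd j' - j'')" for i j i' j' i'' j''
    using that neq[of i i' j j'] neq[of i i'' j j''] neq[of i' i'' j' j'']
    by (intro exI[of _ "{colour16 (m + i) (n + j), colour16 (m + i') (n + j'),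
      colour16 (m + i'') (n + j'')}"]) auto
  define s where "s = (x - of_int m) + (y - of_int n)"
  \<comment> \<open>The diagonal \<open>s = 1\<close> cuts the unit cell into two triangles of M,
    and a point is covered by the tiles centred at the corners of its triangle. On the bottom edge
    the tile at (0,1) misses the point, and the tile at (1,-1), across that edge, replaces it. A
    lattice point lies in its own tile and, through the two included vertices, in those at (1,-1)
    and (0,-1).\<close>
  consider "s > 1" | "0 < s" "s \<le> 1" "y > of_int n" | "0 < s" "s \<le> 1" "y = of_int n" | "s = 0"
    using b unfolding s_def by linarith
  then have "\<exists>C. card C = 3 \<and> C \<subseteq> F"
  proof cases
    case 1
    show ?thesis
      by (rule three[of 1 0 0 1 1 1]; (rule mem)?)
        (use b 1 in \<open>auto simp: half_open_hexagon_def s_def\<close>)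
  next
    case 2
    show ?thesis
      by (rule three[of 0 0 1 0 0 1]; (rule mem)?)
        (use b 2 in \<open>auto simp: half_open_hexagon_def s_def\<close>)
  next
    case 3
    show ?thesis
      by (rule three[of 0 0 1 0 1 "-1"]; (rule mem)?)
        (use b 3 in \<open>auto simp: half_open_hexagon_def s_def\<close>)
  next
    case 4
    then have "x = of_int m" "y = of_int n" using b unfolding s_def by linarith+
    then show ?thesis
      by (intro three[of 0 0 1 "-1" 0 "-1"] mem) (auto simp: half_open_hexagon_def)
  qed
  then show ?thesis unfolding F_def .
qed

text \<open>In coordinates of M the form is four times the squared Euclidean length, so the value 4
  encodes distance 1. The hypotheses describe an open hexagon containing all differences of two
  points of the tile.\<close>

lemma triangular_form_less_4:
  fixes x y :: real
  assumes "\<bar>x\<bar> < 2" "\<bar>y\<bar> < 2" "\<bar>x + y\<bar> < 2"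
  shows "x\<^sup>2 + x * y + y\<^sup>2 < 4"
proof -
  have sq: "x\<^sup>2 < 4" "y\<^sup>2 < 4" "(x + y)\<^sup>2 < 4"
    using assms abs_square_less_1[of "x / 2"] abs_square_less_1[of "y / 2"]
      abs_square_less_1[of "(x + y) / 2"] by (simp_all add: power_divide)
  (* Two of x, y, -(x + y) have the same sign; the form is the square of the third minus their
     product, and is symmetric in the three. *)
  have "0 \<le> x * y \<or> 0 \<le> - x * (x + y) \<or> 0 \<le> - y * (x + y)"
    by (auto simp: zero_le_mult_iff mult_le_0_iff)
  moreover have "x\<^sup>2 + x * y + y\<^sup>2 = (x + y)\<^sup>2 - x * y"
    "x\<^sup>2 + x * y + y\<^sup>2 = y\<^sup>2 - - x * (x + y)" "x\<^sup>2 + x * y + y\<^sup>2 = x\<^sup>2 - - y * (x + y)"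
    by (simp_all add: power2_eq_square algebra_simps)
  ultimately show ?thesis using sq by linarith
qed

text \<open>For \<open>y\<close> nonnegative, \<open>x\<^sup>2\<close> alone exceeds 4. Otherwise
  the form is \<open>(x + y)\<^sup>2 - x * y\<close> with \<open>x * y\<close> nonpositive.\<close>

lemma triangular_form_greater_4:
  fixes x y :: real
  assumes "2 < x" "2 < x + y"
  shows "4 < x\<^sup>2 + x * y + y\<^sup>2"
proof (cases "0 \<le> y")
  case True
  have "2 * 2 < x * x" using assms by (intro mult_strict_mono) auto
  moreover have "0 \<le> x * y" using assms True by simp
  ultimately show ?thesis using zero_le_square[of y] unfolding power2_eq_square by linarith
next
  case False
  have "2 * 2 < (x + y) * (x + y)" using assms by (intro mult_strict_mono) auto
  moreover have "x * y \<le> 0" using assms False by (simp add: mult_le_0_iff)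
  ultimately show ?thesis by (simp add: power2_eq_square algebra_simps)
qed

lemma triangular_form_neq_4:
  fixes d e :: real and a b :: int
  assumes de: "\<bar>d\<bar> < 2" "\<bar>e\<bar> < 2" "\<bar>d + e\<bar> < 2"
  defines "x \<equiv> d + 4 * of_int a" and "y \<equiv> e + 4 * of_int b"
  shows "x\<^sup>2 + x * y + y\<^sup>2 \<noteq> 4"
proof (cases "a = 0 \<and> b = 0")
  case True
  then show ?thesis using triangular_form_less_4[OF de] unfolding x_def y_def by simp
next
  case False
  \<comment> \<open>A nonzero multiple of 4 carries a number from the open interval (-2,2) beyond 2
    in absolute value.\<close>
  have gt: "2 < x" if "1 \<le> a"
    using that de(1) unfolding x_def by linarith
  have lt: "x < - 2" if "a \<le> - 1"
    using that de(1) unfolding x_def by linarith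
  have gt': "2 < y" if "1 \<le> b"
    using that de(2) unfolding y_def by linarith
  have lt': "y < - 2" if "b \<le> - 1"
    using that de(2) unfolding y_def by linarith
  have gts: "2 < x + y" if "1 \<le> a + b"
    using that de(3) unfolding x_def y_def by linarith
  have lts: "x + y < - 2" if "a + b \<le> - 1"
    using that de(3) unfolding x_def y_def by linarith
  (* The six sectors are permuted by the rotation (x, y) -> (x + y, -x) of order 6, which
     preserves the form. *)
  consider "1 \<le> a" "1 \<le> a + b" | "1 \<le> a + b" "1 \<le> b" | "1 \<le> b" "a \<le> - 1"
    | "a \<le> - 1" "a + b \<le> - 1" | "a + b \<le> - 1" "b \<le> - 1" | "b \<le> - 1" "1 \<le> a"
    using False by linarith
  then have "4 < x\<^sup>2 + x * y + y\<^sup>2"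
  proof cases
    case 1
    then show ?thesis using triangular_form_greater_4[of x y] gt gts by simp
  next
    case 2
    then show ?thesis using triangular_form_greater_4[of y x] gt' gts by (simp add: algebra_simps)
  next
    case 3
    then show ?thesis using triangular_form_greater_4[of y "- x - y"] gt' lt
      by (simp add: algebra_simps power2_eq_square)
  next
    case 4
    then show ?thesis using triangular_form_greater_4[of "- x" "- y"] lt lts
      by (simp add: algebra_simps)
  next
    case 5
    then show ?thesis using triangular_form_greater_4[of "- y" "- x"] lt' lts
      by (simp add: algebra_simps)
  next
    case 6
    then show ?thesis using triangular_form_greater_4[of x "- x - y"] gt lt'
      by (simp add: algebra_simps power2_eq_square)
  qed
  then show ?thesis by simp
qed

lemma fold_colouring_3_16: "\<exists>f. fold_colouring unit_distance_graph 3 16 f"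
proof -
  \<comment> \<open>Coordinates with respect to the basis (1/2, 0), (1/4, sqrt 3 / 4) of M.\<close>
  define Y where "Y v = 4 / sqrt 3 * v $ 2" for v :: "real ^ 2"
  define X where "X v = 2 * v $ 1 - Y v / 2" for v :: "real ^ 2"
  show ?thesis
    unfolding unit_distance_graph_def
  proof (rule fold_colouring_of_lattice_colouring
      [where \<kappa> = colour16 and T = half_open_hexagon and X = X and Y = Y])
    fix v w :: "real ^ 2" and m n m' n' :: int
    assume "dist v w = 1"
      and v: "(X v - of_int m, Y v - of_int n) \<in> half_open_hexagon"
      and w: "(X w - of_int m', Y w - of_int n') \<in> half_open_hexagon"
    define p q where "p = v $ 1 - w $ 1" and "q = v $ 2 - w $ 2"
    define x y where "x = X v - X w" and "y = Y v - Y w"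
    have y: "y = 4 / sqrt 3 * q" unfolding y_def Y_def q_def by (simp add: algebra_simps)
    have x: "x = 2 * p - y / 2" unfolding x_def X_def p_def y_def by (simp add: field_simps)
    have "p\<^sup>2 + q\<^sup>2 = 1"
      using dist_real2_eq_1D[OF \<open>dist v w = 1\<close>] unfolding p_def q_def .
    moreover have "3 * y\<^sup>2 = 16 * q\<^sup>2"
      unfolding y by (simp add: power_mult_distrib power_divide)
    ultimately have "x\<^sup>2 + x * y + y\<^sup>2 = 4"
      unfolding x by (simp add: power2_eq_square algebra_simps)
    show "colour16 m n \<noteq> colour16 m' n'"
    proof
      assume "colour16 m n = colour16 m' n'"
      then obtain a b where a: "m - m' = 4 * a" and b: "n - n' = 4 * b"
        using colour16_eqD by (metis dvdE)
      define d e where "d = x - 4 * of_int a" and "e = y - 4 * of_int b"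
      have "4 * real_of_int a = of_int m - of_int m'" "4 * real_of_int b = of_int n - of_int n'"
        using a b by (simp_all flip: of_int_diff)
      then have "d = (X v - of_int m) - (X w - of_int m')" "e = (Y v - of_int n) - (Y w - of_int n')"
        unfolding d_def e_def x_def y_def by simp_all
      \<comment> \<open>Strict, because on the tile each of the three linear forms takes values in a
        half-open interval of length 2.\<close>
      then have "\<bar>d\<bar> < 2" "\<bar>e\<bar> < 2" "\<bar>d + e\<bar> < 2"
        using v w unfolding half_open_hexagon_def by auto
      from triangular_form_neq_4[OF this, of a b] show False
        using \<open>x\<^sup>2 + x * y + y\<^sup>2 = 4\<close> unfolding d_def e_def by simp
    qed
  qed (use colour16_range half_open_hexagon_covers in auto)
qed

section \<open>Two of twelve colours\<close>

text \<open>The vertices are (0, \<plusminus>2/3) and (\<plusminus>1, \<plusminus>1/3), all with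
  \<open>3 * x\<^sup>2 + 9 * y\<^sup>2 = 4\<close>; the hexagon is regular for this form. It tiles
  by the vectors with even coordinate sum.\<close>

definition closed_hexagon :: "(real \<times> real) set" where
  "closed_hexagon = {(x, y). \<bar>x\<bar> \<le> 1 \<and> \<bar>x + 3 * y\<bar> \<le> 2 \<and> \<bar>x - 3 * y\<bar> \<le> 2}"

(* Modulo the lattice generated by (3,2) and (3,-2), the vector (m,n) is equivalent to a unique
   vector with coordinates in {0..5} and {0,1}. *)
definition colour12 :: "int \<Rightarrow> int \<Rightarrow> nat" where
  "colour12 m n = nat ((m - 3 * (n div 2)) mod 6 + 6 * (n mod 2) + 1)"

lemma colour12_range: "colour12 m n \<in> {1..12}"
proof -
  have "0 \<le> (m - 3 * (n div 2)) mod 6" "(m - 3 * (n div 2)) mod 6 < 6" "0 \<le> n mod 2" "n mod 2 < 2"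
    by simp_all
  then show ?thesis unfolding colour12_def by auto
qed

text \<open>The vectors (3a, 2b) with a - b even are exactly those of the lattice generated by (3,2)
  and (3,-2).\<close>

lemma colour12_eqE:
  assumes "colour12 m n = colour12 m' n'"
  obtains a b where "m - m' = 3 * a" "n - n' = 2 * b" "even (a - b)"
proof -
  define d d' where "d = n div 2" and "d' = n' div 2"
  have eq: "(m - 3 * d) mod 6 + 6 * (n mod 2) = (m' - 3 * d') mod 6 + 6 * (n' mod 2)"
    using assms unfolding colour12_def d_def d'_def by (subst (asm) eq_nat_nat_iff) simp_all
  have "0 \<le> (m - 3 * d) mod 6" "(m - 3 * d) mod 6 < 6"
    "0 \<le> (m' - 3 * d') mod 6" "(m' - 3 * d') mod 6 < 6" by simp_all
  with eq have mod_n: "n mod 2 = n' mod 2" by linarith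
  with eq have "(m - 3 * d) mod 6 = (m' - 3 * d') mod 6" by simp
  then obtain c where c: "(m - 3 * d) - (m' - 3 * d') = 6 * c"
    by (metis mod_eq_dvd_iff dvdE)
  show ?thesis
  proof (rule that)
    show "m - m' = 3 * (d - d' + 2 * c)" using c by simp
    have "n = 2 * d + n mod 2" "n' = 2 * d' + n mod 2"
      unfolding d_def d'_def by (simp, metis mod_n mult_div_mod_eq)
    then obtain r where "n = 2 * d + r" "n' = 2 * d' + r" by blast
    then show "n - n' = 2 * (d - d')" by simp
  qed simp
qed

lemma closed_hexagon_covers:
  fixes x y :: real
  shows "\<exists>C. card C = 2 \<and> C \<subseteq> {colour12 m n |m n. (x - of_int m, y - of_int n) \<in> closed_hexagon}"
proof -
  define m n where "m = \<lfloor>x\<rfloor>" and "n = \<lfloor>y\<rfloor>"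
  define F where "F = {colour12 m n |m n. (x - of_int m, y - of_int n) \<in> closed_hexagon}"
  have b: "of_int m \<le> x" "x < of_int m + 1" "of_int n \<le> y" "y < of_int n + 1"
    unfolding m_def n_def by linarith+
  have mem: "colour12 (m + i) (n + j) \<in> F"
    if "(x - of_int m - of_int i, y - of_int n - of_int j) \<in> closed_hexagon" for i j
  proof -
    have "(x - of_int (m + i), y - of_int (n + j)) \<in> closed_hexagon"
      using that by (simp add: algebra_simps)
    then show ?thesis unfolding F_def by blast
  qed
  have neq: "colour12 (m + i) (n + j) \<noteq> colour12 (m + i') (n + j')"
    if "\<not> (3 dvd i - i' \<and> 2 dvd j - j')" for i j i' j'
  proof
    assume "colour12 (m + i) (n + j) = colour12 (m + i') (n + j')"
    then obtain a b where "(m + i) - (m + i') = 3 * a" "(n + j) - (n + j') = 2 * b"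
      by (rule colour12_eqE)
    then show False using that by simp
  qed
  \<comment> \<open>The translates of each parity class of coordinate sums tile the plane, so each
    class supplies one tile. The candidates are opposite corners of the unit cell, separated by the
    line through their common edge.\<close>
  have "colour12 (m + 0) (n + 0) \<in> F \<or> colour12 (m + 1) (n + 1) \<in> F"
  proof (cases "(x - of_int m) + 3 * (y - of_int n) \<le> 2")
    case True
    with b show ?thesis by (intro disjI1 mem) (simp add: closed_hexagon_def abs_le_iff)
  next
    case False
    with b show ?thesis by (intro disjI2 mem) (simp add: closed_hexagon_def abs_le_iff)
  qed
  moreover have "colour12 (m + 1) (n + 0) \<in> F \<or> colour12 (m + 0) (n + 1) \<in> F"
  proof (cases "3 * (y - of_int n) \<le> 1 + (x - of_int m)")
    case True
    with b show ?thesis by (intro disjI1 mem) (simp add: closed_hexagon_def abs_le_iff)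
  next
    case False
    with b show ?thesis by (intro disjI2 mem) (simp add: closed_hexagon_def abs_le_iff)
  qed
  ultimately obtain c c' where "c \<in> F" "c' \<in> F" "c \<noteq> c'"
    using neq[of 0 1 0 0] neq[of 0 0 0 1] neq[of 1 1 1 0] neq[of 1 0 1 1] by auto
  then have "card {c, c'} = 2 \<and> {c, c'} \<subseteq> F" by simp
  then show ?thesis unfolding F_def by blast
qed

text \<open>With \<open>t = \<bar>x\<bar>\<close>, the form is at most
  \<open>3 * t\<^sup>2 + (4 - t)\<^sup>2 = 16 + 4 * t * (t - 2)\<close>, hence at most 16.\<close>

lemma rectangular_form_less_17:
  fixes x y :: real
  assumes "\<bar>x\<bar> \<le> 2" "\<bar>x + 3 * y\<bar> \<le> 4" "\<bar>x - 3 * y\<bar> \<le> 4"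
  shows "3 * x\<^sup>2 + 9 * y\<^sup>2 < 17"
proof -
  have "3 * \<bar>y\<bar> \<le> 4 - \<bar>x\<bar>" using assms by linarith
  then have "(3 * \<bar>y\<bar>)\<^sup>2 \<le> (4 - \<bar>x\<bar>)\<^sup>2" by (rule power_mono) simp
  moreover have "\<bar>x\<bar> * \<bar>x\<bar> \<le> 2 * \<bar>x\<bar>" using assms(1) by (intro mult_right_mono) auto
  ultimately show ?thesis by (simp add: power2_eq_square algebra_simps)
qed

text \<open>Each alternative forces the value 75/4 at least: the first through
  \<open>3 * x\<^sup>2\<close>, the others by splitting four times the form into
  \<open>3 * (x \<plusminus> 3 * y)\<^sup>2\<close> and another square.\<close>

lemma rectangular_form_greater_17:
  fixes x y :: real
  assumes "5 / 2 \<le> \<bar>x\<bar> \<or> 5 \<le> \<bar>x + 3 * y\<bar> \<or> 5 \<le> \<bar>x - 3 * y\<bar>"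
  shows "17 < 3 * x\<^sup>2 + 9 * y\<^sup>2"
proof -
  have "25 / 4 \<le> x\<^sup>2 \<or> 25 \<le> (x + 3 * y)\<^sup>2 \<or> 25 \<le> (x - 3 * y)\<^sup>2"
    using assms power_mono[of "5 / 2" "\<bar>x\<bar>" 2] power_mono[of 5 "\<bar>x + 3 * y\<bar>" 2]
      power_mono[of 5 "\<bar>x - 3 * y\<bar>" 2] by (auto simp: power_divide)
  moreover have "3 * (x + 3 * y)\<^sup>2 + (3 * x - 3 * y)\<^sup>2 = 4 * (3 * x\<^sup>2 + 9 * y\<^sup>2)"
    "3 * (x - 3 * y)\<^sup>2 + (3 * x + 3 * y)\<^sup>2 = 4 * (3 * x\<^sup>2 + 9 * y\<^sup>2)"
    by (simp_all add: power2_eq_square algebra_simps)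
  ultimately show ?thesis
    using zero_le_power2[of "3 * x - 3 * y"] zero_le_power2[of "3 * x + 3 * y"]
      zero_le_power2[of y] by argo
qed

lemma rectangular_form_neq_17:
  fixes d e :: real and a b :: int
  assumes de: "\<bar>d\<bar> \<le> 2" "\<bar>d + 3 * e\<bar> \<le> 4" "\<bar>d - 3 * e\<bar> \<le> 4" and "even (a - b)"
  defines "x \<equiv> d + 3 * of_int a" and "y \<equiv> e + 2 * of_int b"
  shows "3 * x\<^sup>2 + 9 * y\<^sup>2 \<noteq> 17"
proof (cases "a = 0 \<and> b = 0")
  case True
  then show ?thesis using rectangular_form_less_17[OF de(1-3)] unfolding x_def y_def by simp
next
  case False
  \<comment> \<open>If \<open>a = 0\<close>, then \<open>b\<close> is even and nonzero. If
    \<open>\<bar>a\<bar> = 1\<close>, then \<open>b\<close> is odd, and one of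
    \<open>a \<plusminus> 2 * b\<close> has absolute value
    \<open>\<bar>a\<bar> + 2 * \<bar>b\<bar>\<close>.\<close>
  have "2 \<le> \<bar>a\<bar> \<or> 3 \<le> \<bar>a + 2 * b\<bar> \<or> 3 \<le> \<bar>a - 2 * b\<bar>"
  proof (cases "a = 0")
    case True
    then obtain c where "b = 2 * c" using \<open>even (a - b)\<close> by auto
    then show ?thesis using False True by auto
  next
    case nonzero: False
    then have "b \<noteq> 0 \<or> 2 \<le> \<bar>a\<bar>" using \<open>even (a - b)\<close> by auto
    then show ?thesis using nonzero by linarith
  qed
  then have "2 \<le> \<bar>real_of_int a\<bar> \<or> 3 \<le> \<bar>real_of_int a + 2 * of_int b\<bar>
      \<or> 3 \<le> \<bar>real_of_int a - 2 * of_int b\<bar>"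
    by linarith
  \<comment> \<open>The shift changes \<open>x \<plusminus> 3 * y\<close> by
    \<open>3 * (a \<plusminus> 2 * b)\<close>, leaving at least 9 - 4 = 5; for \<open>x\<close> at
    least 6 - 2 = 4 remains.\<close>
  then have "5 / 2 \<le> \<bar>x\<bar> \<or> 5 \<le> \<bar>x + 3 * y\<bar> \<or> 5 \<le> \<bar>x - 3 * y\<bar>"
    using de unfolding x_def y_def by argo
  from rectangular_form_greater_17[OF this] show ?thesis by simp
qed

(* The unit circle is 3 x^2 + 9 y^2 = 17 in lattice coordinates; any constant strictly between 16
   (the maximum over the difference body) and 75/4 (the bound for its translates) would do. *)
lemma fold_colouring_2_12: "\<exists>f. fold_colouring unit_distance_graph 2 12 f"
proof -
  define X where "X v = sqrt (17 / 3) * v $ 1" for v :: "real ^ 2"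
  define Y where "Y v = sqrt (17 / 9) * v $ 2" for v :: "real ^ 2"
  show ?thesis
    unfolding unit_distance_graph_def
  proof (rule fold_colouring_of_lattice_colouring
      [where \<kappa> = colour12 and T = closed_hexagon and X = X and Y = Y])
    fix v w :: "real ^ 2" and m n m' n' :: int
    assume "dist v w = 1"
      and v: "(X v - of_int m, Y v - of_int n) \<in> closed_hexagon"
      and w: "(X w - of_int m', Y w - of_int n') \<in> closed_hexagon"
    define x y where "x = X v - X w" and "y = Y v - Y w"
    have "x = sqrt (17 / 3) * (v $ 1 - w $ 1)" "y = sqrt (17 / 9) * (v $ 2 - w $ 2)"
      unfolding x_def y_def X_def Y_def by (simp_all only: right_diff_distrib)
    then have "3 * x\<^sup>2 + 9 * y\<^sup>2 = 17 * ((v $ 1 - w $ 1)\<^sup>2 + (v $ 2 - w $ 2)\<^sup>2)"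
      by (simp only: power_mult_distrib real_sqrt_pow2) simp
    then have "3 * x\<^sup>2 + 9 * y\<^sup>2 = 17"
      using dist_real2_eq_1D[OF \<open>dist v w = 1\<close>] by simp
    show "colour12 m n \<noteq> colour12 m' n'"
    proof
      assume "colour12 m n = colour12 m' n'"
      then obtain a b where a: "m - m' = 3 * a" and b: "n - n' = 2 * b" and "even (a - b)"
        by (rule colour12_eqE)
      define d e where "d = x - 3 * of_int a" and "e = y - 2 * of_int b"
      have "3 * real_of_int a = of_int m - of_int m'" "2 * real_of_int b = of_int n - of_int n'"
        using a b by (simp_all flip: of_int_diff)
      then have "d = (X v - of_int m) - (X w - of_int m')" "e = (Y v - of_int n) - (Y w - of_int n')"
        unfolding d_def e_def x_def y_def by simp_all
      then have "\<bar>d\<bar> \<le> 2" "\<bar>d + 3 * e\<bar> \<le> 4" "\<bar>d - 3 * e\<bar> \<le> 4"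
        using v w unfolding closed_hexagon_def by auto
      from rectangular_form_neq_17[OF this \<open>even (a - b)\<close>] show False
        using \<open>3 * x\<^sup>2 + 9 * y\<^sup>2 = 17\<close> unfolding d_def e_def by simp
    qed
  qed (use colour12_range closed_hexagon_covers in auto)
qed

section \<open>Bounds on the fold chromatic numbers\<close>

lemma fold_chromatic_number_le:
  assumes "\<exists>f. fold_colouring G j k f"
  shows "fold_chromatic_number G j \<le> k"
  unfolding fold_chromatic_number_def using assms by (rule Least_le)

theorem theorem4:
  shows "(\<exists>f. fold_colouring unit_distance_graph 2 12 f) \<and>
         (\<exists>f. fold_colouring unit_distance_graph 3 16 f) \<and>
         fold_chromatic_number unit_distance_graph 2 \<le> 12 \<and>
         fold_chromatic_number unit_distance_graph 3 \<le> 16"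
  using fold_colouring_2_12 fold_colouring_3_16 fold_chromatic_number_le by blast

end
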